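(* Consider a Boolean control network with algebraic form $x(t+1)=Lu(t)x(t)$, $y(t)=Hx(t)$, where $x(t)\in\Delta_{2^n}$, $u(t)\in\Delta_{2^m}$, $y(t)\in\Delta_{2^p}$. Let $$P^d=\{s^d_j : j=1,\dots,2^p\},\quad s^d_j=\{x\in\Delta_{2^n} : Hx=\delta_{2^p}^j\},$$ $$P^0=\{s^0_i : i=1,\dots,2^n\},\quad s^0_i=\{\delta_{2^n}^i\}.$$ Then the network is output controllable if and only if it is set controllable with respect to the family of initial sets $P^0$ and the family of destination sets $P^d$.
   Context: Boolean control network: $x_i(t+1)=f_i(x_1(t),\dots,x_n(t);u_1(t),\dots,u_m(t))$, $i=1,\dots,n$, and $y_j(t)=h_j(x_1(t),\dots,x_n(t))$, $j=1,\dots,p$, with all variables in $\mathcal D=\{0,1\}$ and $f_i:\mathcal D^{m+n}\to\mathcal D$, $h_j:\mathcal D^n\to\mathcal D$ arbitrary Boolean functions. Algebraic form: let $\delta_k^i$ be the $i$-th column of the identity matrix $I_k$ and $\Delta_k=\{\delta_k^1,\dots,\delta_k^k\}$. Identify $1\sim\delta_2^1$, $0\sim\delta_2^2$. Products of matrices and vectors are semi-tensor products: for $A$ of size $a\times b$ and $B$ of size $c\times d$, with $t=\mathrm{lcm}(b,c)$, $A\ltimes B=(A\otimes I_{t/b})(B\otimes I_{t/c})$; for column vectors this is the Kronecker product. Put $x(t)=x_1(t)\ltimes\cdots\ltimes x_n(t)\in\Delta_{2^n}$, $u(t)=u_1(t)\ltimes\cdots\ltimes u_m(t)\in\Delta_{2^m}$,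 $y(t)=y_1(t)\ltimes\cdots\ltimes y_p(t)\in\Delta_{2^p}$. The network is then equivalently written $x(t+1)=Lu(t)x(t)$, $y(t)=Hx(t)$ with unique matrices $L$ of size $2^n\times 2^{n+m}$ and $H$ of size $2^p\times 2^n$, whose columns lie in $\Delta_{2^n}$ and $\Delta_{2^p}$ respectively. Output controllability: the network is output controllable if for any $x(0)=x_0\in\Delta_{2^n}$ and any $y_d\in\Delta_{2^p}$ there exist $T>0$ and controls $u(0),\dots,u(T-1)$ such that $y(T)=y_d$. Set controllability: a state $x_d$ is controllable from a state $x_0$ if there are $T>0$ and controls $u(0),\dots,u(T-1)$ driving the trajectory from $x(0)=x_0$ to $x(T)=x_d$. Given a family $P^0$ of initial sets of states and a family $P^d$ of destination sets of states, the system is set controllable if for every $s^0\in P^0$ and every $s^d\in P^d$ there exist $x_0\in s^0$ and $x_d\in s^d$ such that $x_d$ is controllable from $x_0$. *)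

theory Defs
  imports "Jordan_Normal_Form.Matrix"
begin

definition kronecker :: "real mat \<Rightarrow> real mat \<Rightarrow> real mat" (infixl "\<otimes>\<^sub>k" 72) where
  "A \<otimes>\<^sub>k B = mat (dim_row A * dim_row B) (dim_col A * dim_col B)
     (\<lambda>(i, j). A $$ (i div dim_row B, j div dim_col B) * B $$ (i mod dim_row B, j mod dim_col B))"

definition stp :: "real mat \<Rightarrow> real mat \<Rightarrow> real mat" (infixl "\<Join>" 71) where
  "A \<Join> B = (let t = lcm (dim_col A) (dim_row B) in
     (A \<otimes>\<^sub>k 1\<^sub>m (t div dim_col A)) * (B \<otimes>\<^sub>k 1\<^sub>m (t div dim_row B)))"

text \<open>Column vectors are one-column matrices, so that the semi-tensor product applies to them.
  Columns of the identity are numbered from 1, as in the literature, whereas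
  matrix indices start from 0.\<close>

definition delta :: "nat \<Rightarrow> nat \<Rightarrow> real mat" where
  "delta k i = mat_of_cols k [col (1\<^sub>m k) (i - 1)]"

definition Delta :: "nat \<Rightarrow> real mat set" where
  "Delta k = delta k ` {1..k}"

definition bool_vec :: "bool \<Rightarrow> real mat" where
  "bool_vec b = (if b then delta 2 1 else delta 2 2)"

text \<open>The product of the vector forms of a tuple of Boolean values; the trailing factor is the
  one-by-one identity, which is neutral for the semi-tensor product.\<close>

definition stp_vec :: "bool list \<Rightarrow> real mat" where
  "stp_vec bs = foldr (\<lambda>b v. bool_vec b \<Join> v) bs (1\<^sub>m 1)"

text \<open>A Boolean control network with \<open>n\<close> states, \<open>m\<close> inputs and \<open>p\<close> outputs is given by functions
  \<open>f i x u\<close> (\<open>1 \<le> i \<le> n\<close>) and \<open>h j x\<close> (\<open>1 \<le> j \<le> p\<close>), where \<open>x\<close> and \<open>u\<close> are Boolean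
  tuples of length \<open>n\<close> and \<open>m\<close>; other arguments are irrelevant.\<close>

definition bcn_next :: "nat \<Rightarrow> (nat \<Rightarrow> bool list \<Rightarrow> bool list \<Rightarrow> bool) \<Rightarrow> bool list \<Rightarrow> bool list \<Rightarrow> bool list" where
  "bcn_next n f x u = map (\<lambda>i. f i x u) [1..<Suc n]"

definition bcn_output :: "nat \<Rightarrow> (nat \<Rightarrow> bool list \<Rightarrow> bool) \<Rightarrow> bool list \<Rightarrow> bool list" where
  "bcn_output p h x = map (\<lambda>j. h j x) [1..<Suc p]"

definition logical_matrix :: "nat \<Rightarrow> nat \<Rightarrow> real mat \<Rightarrow> bool" where
  "logical_matrix r c M \<longleftrightarrow> M \<in> carrier_mat r c \<and>
     (\<forall>k<c. mat_of_cols r [col M k] \<in> Delta r)"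

definition algebraic_form ::
  "nat \<Rightarrow> nat \<Rightarrow> nat \<Rightarrow> (nat \<Rightarrow> bool list \<Rightarrow> bool list \<Rightarrow> bool) \<Rightarrow> (nat \<Rightarrow> bool list \<Rightarrow> bool)
    \<Rightarrow> real mat \<Rightarrow> real mat \<Rightarrow> bool" where
  "algebraic_form n m p f h L H \<longleftrightarrow>
     logical_matrix (2 ^ n) (2 ^ (n + m)) L \<and> logical_matrix (2 ^ p) (2 ^ n) H \<and>
     (\<forall>x u. length x = n \<and> length u = m \<longrightarrow>
        stp_vec (bcn_next n f x u) = L \<Join> stp_vec u \<Join> stp_vec x) \<and>
     (\<forall>x. length x = n \<longrightarrow> stp_vec (bcn_output p h x) = H \<Join> stp_vec x)"

primrec trajectory :: "real mat \<Rightarrow> real mat \<Rightarrow> (nat \<Rightarrow> real mat) \<Rightarrow> nat \<Rightarrow> real mat" where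
  "trajectory L x0 u 0 = x0"
| "trajectory L x0 u (Suc t) = L \<Join> u t \<Join> trajectory L x0 u t"

definition output_controllable :: "nat \<Rightarrow> nat \<Rightarrow> nat \<Rightarrow> real mat \<Rightarrow> real mat \<Rightarrow> bool" where
  "output_controllable n m p L H \<longleftrightarrow>
     (\<forall>x0 \<in> Delta (2 ^ n). \<forall>yd \<in> Delta (2 ^ p).
        \<exists>T u. T > 0 \<and> (\<forall>t<T. u t \<in> Delta (2 ^ m)) \<and> H \<Join> trajectory L x0 u T = yd)"

definition controllable_from :: "nat \<Rightarrow> real mat \<Rightarrow> real mat \<Rightarrow> real mat \<Rightarrow> bool" where
  "controllable_from m L xd x0 \<longleftrightarrow>
     (\<exists>T u. T > 0 \<and> (\<forall>t<T. u t \<in> Delta (2 ^ m)) \<and> trajectory L x0 u T = xd)"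

definition set_controllable ::
  "nat \<Rightarrow> real mat \<Rightarrow> real mat set set \<Rightarrow> real mat set set \<Rightarrow> bool" where
  "set_controllable m L P0 Pd \<longleftrightarrow>
     (\<forall>s0 \<in> P0. \<forall>sd \<in> Pd. \<exists>x0 \<in> s0. \<exists>xd \<in> sd. controllable_from m L xd x0)"

text \<open>Every network has exactly one algebraic form, and its trajectories are those of the
  Boolean network under the identification \<open>stp_vec\<close>.\<close>

lemma dim_delta[simp]: "dim_row (delta k i) = k" "dim_col (delta k i) = 1" by (auto simp: delta_def)
lemma index_delta: "r < k \<Longrightarrow> 1 \<le> i \<Longrightarrow> i \<le> k \<Longrightarrow> delta k i $$ (r, 0) = (if r = i - 1 then 1 else 0)"
  by (auto simp: delta_def mat_of_cols_def col_def)

lemma kron_one: "A \<otimes>\<^sub>k 1\<^sub>m 1 = A"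
  by (rule eq_matI) (auto simp: kronecker_def)

lemma stp_delta:
  assumes A: "A \<in> carrier_mat r (M*N)" and M: "N > 0" "1 \<le> a" "a \<le> M"
  shows "A \<Join> delta M a = mat r N (\<lambda>(i,j). A $$ (i, (a-1)*N+j))"
proof -
  have [simp]: "dim_row A = r" "dim_col A = M*N" using A by auto
  have M0: "M > 0" using M by auto
  have 1: "A \<Join> delta M a = A * (delta M a \<otimes>\<^sub>k 1\<^sub>m N)"
    using M M0 kron_one[of A] by (simp add: stp_def Let_def)
  have lt: "(a-1)*N + j < M*N" if "j < N" for j
  proof -
    have "(a-1)*N + j < (a-1)*N + N" using that by simp
    also have "\<dots> = a * N" using M by (simp add: algebra_simps diff_mult_distrib)
    also have "\<dots> \<le> M*N" using M by simp
    finally show ?thesis .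
  qed
  show ?thesis unfolding 1
  proof (rule eq_matI, goal_cases)
    case (1 i j)
    then have ij: "i < r" "j < N" by auto
    have D: "(delta M a \<otimes>\<^sub>k 1\<^sub>m N) $$ (k, j) = (if k = (a-1)*N+j then 1 else 0)" if "k < M*N" for k
    proof -
      have kd: "k div N < M" using that M by (simp add: less_mult_imp_div_less)
      have "(delta M a \<otimes>\<^sub>k 1\<^sub>m N) $$ (k, j) = delta M a $$ (k div N, 0) * (if k mod N = j then 1 else 0)"
        using that ij M by (simp add: kronecker_def)
      also have "\<dots> = (if k = (a-1)*N+j then 1 else 0)"
        using kd M ij by (auto simp: index_delta) (metis div_mult_mod_eq)
      finally show ?thesis .
    qed
    have "(A * (delta M a \<otimes>\<^sub>k 1\<^sub>m N)) $$ (i, j) = (\<Sum>k<M*N. A $$ (i,k) * (delta M a \<otimes>\<^sub>k 1\<^sub>m N) $$ (k, j))"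
      using ij by (simp add: scalar_prod_def kronecker_def lessThan_atLeast0)
    also have "\<dots> = (\<Sum>k<M*N. if k = (a-1)*N+j then A $$ (i,k) else 0)"
      by (rule sum.cong) (auto simp: D)
    also have "\<dots> = A $$ (i, (a-1)*N+j)" using lt[OF ij(2)] by (simp add: sum.delta)
    finally show ?case using ij by simp
  qed (auto simp: kronecker_def)
qed

primrec bool_index :: "bool list \<Rightarrow> nat" where
  "bool_index [] = 0" | "bool_index (b#bs) = (if b then 0 else 2^length bs) + bool_index bs"

lemma bool_index_less: "bool_index bs < 2^length bs" by (induction bs) auto

lemma delta_stp_delta:
  assumes "1 \<le> a" "a \<le> M" "1 \<le> b" "b \<le> N"
  shows "delta M a \<Join> delta N b = delta (M*N) ((a-1)*N+b)"
proof -
  have 1: "delta M a \<Join> delta N b = (delta M a \<otimes>\<^sub>k 1\<^sub>m N) * delta N b"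
    using assms kron_one[of "delta N b"] by (simp add: stp_def)
  have lt: "(a-1)*N + b \<le> M*N"
  proof -
    have "(a-1)*N + b \<le> (a-1)*N + N" using assms by simp
    also have "\<dots> = a * N" using assms by (simp add: algebra_simps diff_mult_distrib)
    also have "\<dots> \<le> M*N" using assms by simp
    finally show ?thesis .
  qed
  show ?thesis unfolding 1
  proof (rule eq_matI, goal_cases)
    case (1 i j)
    then have i: "i < M*N" and [simp]: "j = 0" by auto
    have id: "i div N < M" using i by (simp add: less_mult_imp_div_less)
    have N0: "N > 0" using assms by auto
    have "((delta M a \<otimes>\<^sub>k 1\<^sub>m N) * delta N b) $$ (i, 0) = (\<Sum>k<N. (if i div N = a-1 \<and> i mod N = k then 1 else 0) * delta N b $$ (k,0))"
      using i id assms N0 by (auto simp: scalar_prod_def kronecker_def lessThan_atLeast0 index_delta intro!: sum.cong)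
    also have "\<dots> = (\<Sum>k<N. if k = b-1 then (if i div N = a-1 \<and> i mod N = k then 1 else 0) else 0)"
      using assms by (intro sum.cong) (auto simp: index_delta)
    also have "\<dots> = (if i div N = a-1 \<and> i mod N = b-1 then 1 else 0)" using assms by (simp add: sum.delta; auto)
    also have "\<dots> = (if i = (a-1)*N+b-1 then 1 else 0)"
    proof -
      have "(i div N = a-1 \<and> i mod N = b-1) \<longleftrightarrow> i = (a-1)*N+(b-1)"
      proof
        assume "i div N = a-1 \<and> i mod N = b-1" then show "i = (a-1)*N+(b-1)" by (metis div_mult_mod_eq)
      next
        assume e: "i = (a-1)*N+(b-1)"
        have "b - 1 < N" using assms by auto
        then show "i div N = a-1 \<and> i mod N = b-1" unfolding e by auto
      qed
      moreover have "(a-1)*N+(b-1) = (a-1)*N+b-1" using assms by simp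
      ultimately show ?thesis by metis
    qed
    finally show ?case using i lt assms by (simp add: index_delta)
  qed (auto simp: kronecker_def)
qed

lemma stp_vec_eq_delta: "stp_vec bs = delta (2^length bs) (bool_index bs + 1)"
proof (induction bs)
  case Nil show ?case by (rule eq_matI) (auto simp: stp_vec_def index_delta)
next
  case (Cons b bs)
  have "stp_vec (b#bs) = bool_vec b \<Join> stp_vec bs" by (simp add: stp_vec_def)
  then show ?case using bool_index_less[of bs] by (auto simp: Cons bool_vec_def delta_stp_delta)
qed

lemma bool_index_inj: "length x = length y \<Longrightarrow> bool_index x = bool_index y \<Longrightarrow> x = y"
proof (induction x y rule: list_induct2)
  case (Cons a x b y)
  then show ?case using bool_index_less[of x] bool_index_less[of y] by (auto split: if_splits)
qed auto

lemma bool_index_surj: "k < 2^n \<Longrightarrow> \<exists>x. length x = n \<and> bool_index x = k"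
proof (induction n arbitrary: k)
  case (Suc n)
  show ?case
  proof (cases "k < 2^n")
    case True
    then obtain x where "length x = n" "bool_index x = k" using Suc by auto
    then show ?thesis by (intro exI[of _ "True#x"]) auto
  next
    case False
    then have "k - 2^n < 2^n" using Suc by auto
    then obtain x where "length x = n" "bool_index x = k - 2^n" using Suc by blast
    then show ?thesis using False by (intro exI[of _ "False#x"]) auto
  qed
qed auto

lemma bij_betw_stp_vec: "bij_betw stp_vec {x. length x = n} (Delta (2^n))"
proof -
  have "inj_on stp_vec {x. length x = n}"
  proof (rule inj_onI, clarsimp)
    fix x y :: "bool list" assume e: "stp_vec x = stp_vec y" and l: "length y = length x"
    have "delta (2^length x) (bool_index x + 1) $$ (bool_index x, 0) = delta (2^length x) (bool_index y + 1) $$ (bool_index x, 0)"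
      using e l by (simp add: stp_vec_eq_delta)
    then have "bool_index x = bool_index y" using bool_index_less[of x] bool_index_less[of y] l by (simp add: index_delta split: if_splits)
    then show "x = y" using l bool_index_inj by auto
  qed
  moreover have "stp_vec ` {x. length x = n} = Delta (2^n)"
  proof -
    have "\<exists>x. length x = n \<and> delta (2^n) i = stp_vec x" if "1 \<le> i" "i \<le> 2^n" for i
      using bool_index_surj[of "i-1" n] that by (force simp: stp_vec_eq_delta)
    moreover have "stp_vec x \<in> Delta (2^length x)" for x
      using bool_index_less[of x] by (auto simp: stp_vec_eq_delta Delta_def)
    ultimately show ?thesis by (auto simp: Delta_def image_iff; metis)
  qed
  ultimately show ?thesis by (simp add: bij_betw_def)
qed

lemma stp_state_input: assumes "L \<in> carrier_mat (2^n) (2^(n+m))" "length x = n" "length u = m"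
  shows "L \<Join> stp_vec u \<Join> stp_vec x = mat_of_cols (2^n) [col L (bool_index u * 2^n + bool_index x)]" (is "?l = _")
proof -
  have lt: "bool_index u * 2^n + bool_index x < 2^m*2^n"
  proof -
    have "bool_index u * 2^n + bool_index x < (bool_index u + 1) * 2^n" using bool_index_less[of x] assms by simp
    also have "\<dots> \<le> 2^m*2^n" using bool_index_less[of u] assms by (intro mult_right_mono) auto
    finally show ?thesis .
  qed
  have 1: "L \<Join> stp_vec u = mat (2^n) (2^n) (\<lambda>(i,j). L $$ (i, bool_index u*2^n+j))" (is "_ = ?B")
    using stp_delta[of L "2^n" "2^m" "2^n" "bool_index u + 1"] assms bool_index_less[of u] by (simp add: stp_vec_eq_delta power_add mult.commute)
  have "?B \<Join> stp_vec x = mat (2^n) 1 (\<lambda>(i,j). ?B $$ (i, bool_index x + j))"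
    using stp_delta[of ?B "2^n" "2^n" 1 "bool_index x + 1"] assms bool_index_less[of x] by (simp add: stp_vec_eq_delta)
  then have "?l = mat (2^n) 1 (\<lambda>(i,j). ?B $$ (i, bool_index x + j))" unfolding 1 .
  also have "\<dots> = mat_of_cols (2^n) [col L (bool_index u * 2^n + bool_index x)]"
    using assms lt bool_index_less[of x] by (intro eq_matI) (auto simp: mat_of_cols_def power_add mult.commute)
  finally show ?thesis .
qed

lemma stp_output: assumes "H \<in> carrier_mat r (2^n)" "length x = n"
  shows "H \<Join> stp_vec x = mat_of_cols r [col H (bool_index x)]"
  using stp_delta[of H r "2^n" 1 "bool_index x + 1"] assms bool_index_less[of x]
  by (auto simp: stp_vec_eq_delta mat_of_cols_def intro!: eq_matI)

theorem trajectory_boolean: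
  assumes "algebraic_form n m p f h L H" "length (X 0) = n" "\<And>t. length (u t) = m"
    "\<And>t. X (Suc t) = bcn_next n f (X t) (u t)"
  shows "trajectory L (stp_vec (X 0)) (\<lambda>t. stp_vec (u t)) t = stp_vec (X t)"
    and "H \<Join> trajectory L (stp_vec (X 0)) (\<lambda>t. stp_vec (u t)) t = stp_vec (bcn_output p h (X t))"
proof -
  have l: "length (X t) = n" for t using assms by (cases t) (auto simp: bcn_next_def)
  show 1: "trajectory L (stp_vec (X 0)) (\<lambda>t. stp_vec (u t)) t = stp_vec (X t)"
    by (induction t) (use assms l in \<open>auto simp: algebraic_form_def\<close>)
  show "H \<Join> trajectory L (stp_vec (X 0)) (\<lambda>t. stp_vec (u t)) t = stp_vec (bcn_output p h (X t))"
    unfolding 1 using assms l by (auto simp: algebraic_form_def)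
qed

lemma bool_index_pair_surj: assumes "k < 2^(n+m)" shows "\<exists>x u. length x = n \<and> length u = m \<and> bool_index u * 2^n + bool_index x = k"
proof -
  have "k div 2^n < 2^m" "k mod 2^n < 2^n" using assms by (auto simp: power_add less_mult_imp_div_less mult.commute)
  then obtain x u where "length x = n" "length u = m" "bool_index x = k mod 2^n" "bool_index u = k div 2^n"
    using bool_index_surj by metis
  then show ?thesis by (metis div_mult_mod_eq)
qed

lemma mat_of_cols_single_inj: "dim_vec v = r \<Longrightarrow> dim_vec w = r \<Longrightarrow> mat_of_cols r [v] = mat_of_cols r [w] \<Longrightarrow> v = w"
  by (metis carrier_vec_dim_vec col_mat_of_cols length_Cons nth_Cons_0 zero_less_Suc)

theorem algebraic_form_unique:
  assumes "algebraic_form n m p f h L H" "algebraic_form n m p f h L' H'"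
  shows "L = L'" "H = H'"
proof -
  note a = assms[unfolded algebraic_form_def logical_matrix_def]
  show "L = L'"
  proof (rule mat_col_eqI)
    fix k assume "k < dim_col L'"
    then have "k < 2^(n+m)" using a by auto
    then obtain x u where xu: "length x = n" "length u = m" "bool_index u * 2^n + bool_index x = k" using bool_index_pair_surj by blast
    have "mat_of_cols (2^n) [col L k] = mat_of_cols (2^n) [col L' k]"
      using stp_state_input[of L n m x u] stp_state_input[of L' n m x u] a xu by auto
    then show "col L k = col L' k" using a by (intro mat_of_cols_single_inj) auto
  qed (use a in auto)
  show "H = H'"
  proof (rule mat_col_eqI)
    fix k assume "k < dim_col H'"
    then have "k < 2^n" using a by auto
    then obtain x where x: "length x = n" "bool_index x = k" using bool_index_surj by blast
    have "mat_of_cols (2^p) [col H k] = mat_of_cols (2^p) [col H' k]"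
      using stp_output[of H "2^p" n x] stp_output[of H' "2^p" n x] a x by auto
    then show "col H k = col H' k" using a by (intro mat_of_cols_single_inj) auto
  qed (use a in auto)
qed

theorem algebraic_form_exists: "\<exists>L H. algebraic_form n m p f h L H"
proof -
  define bl where "bl n k = (THE x. length x = n \<and> bool_index x = k)" for n k
  have bl: "bl (length x) (bool_index x) = x" for x unfolding bl_def using bool_index_inj by blast
  define L where "L = mat_of_cols (2^n) (map (\<lambda>k. col (stp_vec (bcn_next n f (bl n (k mod 2^n)) (bl m (k div 2^n)))) 0) [0..<2^(n+m)])"
  define H where "H = mat_of_cols (2^p) (map (\<lambda>k. col (stp_vec (bcn_output p h (bl n k))) 0) [0..<2^n])"
  have rebuild: "mat_of_cols (2^length v) [col (stp_vec v) 0] = stp_vec v" for v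
    by (rule eq_matI) (auto simp: stp_vec_eq_delta mat_of_cols_def)
  have rb: "mat_of_cols (2^n) [col (stp_vec (bcn_next n f x u)) 0] = stp_vec (bcn_next n f x u)" for x u
    using rebuild[of "bcn_next n f x u"] by (simp add: bcn_next_def del: upt_Suc)
  have rb': "mat_of_cols (2^p) [col (stp_vec (bcn_output p h x)) 0] = stp_vec (bcn_output p h x)" for x
    using rebuild[of "bcn_output p h x"] by (simp add: bcn_output_def del: upt_Suc)
  have d: "stp_vec (bcn_next n f x u) \<in> Delta (2^n)" "stp_vec (bcn_output p h x) \<in> Delta (2^p)" for x u
    by (rule bij_betw_apply[OF bij_betw_stp_vec], simp add: bcn_next_def bcn_output_def del: upt_Suc)+
  have cv: "dim_row (stp_vec (bcn_next n f x u)) = 2^n" "dim_row (stp_vec (bcn_output p h x)) = 2^p" for x u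
    by (auto simp: stp_vec_eq_delta bcn_next_def bcn_output_def)
  have cL: "col L k = col (stp_vec (bcn_next n f (bl n (k mod 2^n)) (bl m (k div 2^n)))) 0" if "k < 2^(n+m)" for k
    unfolding L_def using that cv by (subst col_mat_of_cols) (auto intro!: carrier_vecI)
  have cH: "col H k = col (stp_vec (bcn_output p h (bl n k))) 0" if "k < 2^n" for k
    unfolding H_def using that cv by (subst col_mat_of_cols) (auto intro!: carrier_vecI)
  have L: "L \<in> carrier_mat (2^n) (2^(n+m))" "H \<in> carrier_mat (2^p) (2^n)" by (auto simp: L_def H_def)
  have "algebraic_form n m p f h L H" unfolding algebraic_form_def logical_matrix_def
  proof (intro conjI allI impI)
    fix x u :: "bool list" assume xu: "length x = n \<and> length u = m"
    have lt: "bool_index u * 2^n + bool_index x < 2^(n+m)"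
    proof -
      have "bool_index u * 2^n + bool_index x < (bool_index u + 1) * 2^n" using bool_index_less[of x] xu by simp
      also have "\<dots> \<le> 2^m*2^n" using bool_index_less[of u] xu by (intro mult_right_mono) auto
      finally show ?thesis by (simp add: power_add mult.commute)
    qed
    have "(bool_index u * 2^n + bool_index x) mod 2^n = bool_index x" "(bool_index u * 2^n + bool_index x) div 2^n = bool_index u" using bool_index_less[of x] xu by auto
    then show "stp_vec (bcn_next n f x u) = L \<Join> stp_vec u \<Join> stp_vec x"
      using stp_state_input[OF L(1), of x u] cL[OF lt] rb xu bl by metis
  next
    fix x :: "bool list" assume x: "length x = n"
    then show "stp_vec (bcn_output p h x) = H \<Join> stp_vec x"
      using stp_output[OF L(2), of x] cH[of "bool_index x"] bool_index_less[of x] rb' bl[of x] by auto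
  qed (use L cL cH rb rb' d in auto)
  then show ?thesis by blast
qed

end

theory Submission
  imports Defs
begin

text \<open>A singleton initial set leaves no choice of \<open>x0\<close>, and a trajectory from
  \<open>x0\<close> ends in the destination set of \<open>yd\<close> at time \<open>T\<close>
  exactly when \<open>H\<close> maps its endpoint to \<open>yd\<close> and that endpoint lies in
  \<open>Delta (2 ^ n)\<close>. The second condition always holds by
  \<open>trajectory_in_Delta\<close>, so the same \<open>T\<close> and controls serve both notions.
  If no state has output \<open>yd\<close>, the destination set is empty and both notions
  fail.\<close>

text \<open>Pulled back along the bijection \<open>stp_vec\<close>, the matrix step becomes a
  Boolean update, whose result again has length \<open>n\<close>.\<close>

lemma algebraic_form_step_in_Delta:
  assumes "algebraic_form n m p f h L H" "v \<in> Delta (2 ^ m)" "x \<in> Delta (2 ^ n)"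
  shows "L \<Join> v \<Join> x \<in> Delta (2 ^ n)"
proof -
  obtain bv bx where b: "length bv = m" "v = stp_vec bv" "length bx = n" "x = stp_vec bx"
    using assms(2,3) bij_betw_imp_surj_on[OF bij_betw_stp_vec] by blast
  then have "L \<Join> v \<Join> x = stp_vec (bcn_next n f bx bv)"
    using assms(1) by (simp add: algebraic_form_def)
  moreover have "length (bcn_next n f bx bv) = n"
    by (simp add: bcn_next_def del: upt_Suc)
  ultimately show ?thesis
    using bij_betw_apply[OF bij_betw_stp_vec[of n]] by simp
qed

lemma trajectory_in_Delta:
  assumes "algebraic_form n m p f h L H" "x0 \<in> Delta (2 ^ n)" "\<forall>t<T. u t \<in> Delta (2 ^ m)"
  shows "trajectory L x0 u T \<in> Delta (2 ^ n)"
  using assms(3) by (induction T) (simp_all add: assms(2) algebraic_form_step_in_Delta[OF assms(1)])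

theorem mainTheorem3:
  fixes n m p :: nat
    and f :: "nat \<Rightarrow> bool list \<Rightarrow> bool list \<Rightarrow> bool"
    and h :: "nat \<Rightarrow> bool list \<Rightarrow> bool"
    and L H :: "real mat"
    and s0 sd :: "nat \<Rightarrow> real mat set"
    and P0 Pd :: "real mat set set"
  assumes "algebraic_form n m p f h L H"
    and "\<And>j. sd j = {x \<in> Delta (2 ^ n). H \<Join> x = delta (2 ^ p) j}"
    and "Pd = {sd j | j. j \<in> {1..2 ^ p}}"
    and "\<And>i. s0 i = {delta (2 ^ n) i}"
    and "P0 = {s0 i | i. i \<in> {1..2 ^ n}}"
  shows "output_controllable n m p L H \<longleftrightarrow> set_controllable m L P0 Pd"
proof -
  \<comment> \<open>Reindexing both families by vectors instead of column numbers turns quantifiers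
    over sets into quantifiers over \<open>x0\<close> and \<open>yd\<close>.\<close>
  have P0: "P0 = (\<lambda>x. {x}) ` Delta (2 ^ n)"
    unfolding assms(4,5) Delta_def image_image by (rule Setcompr_eq_image)
  have Pd: "Pd = (\<lambda>y. {x \<in> Delta (2 ^ n). H \<Join> x = y}) ` Delta (2 ^ p)"
    unfolding assms(2,3) Delta_def[of "2 ^ p"] image_image by (rule Setcompr_eq_image)
  \<comment> \<open>From right to left, the witness \<open>xd\<close> is the endpoint of the
    trajectory.\<close>
  have reach: "(\<exists>xd \<in> {x \<in> Delta (2 ^ n). H \<Join> x = yd}. controllable_from m L xd x0) \<longleftrightarrow>
      (\<exists>T u. T > 0 \<and> (\<forall>t<T. u t \<in> Delta (2 ^ m)) \<and> H \<Join> trajectory L x0 u T = yd)"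
    if "x0 \<in> Delta (2 ^ n)" for x0 yd
    using trajectory_in_Delta[OF assms(1) that] unfolding controllable_from_def by blast
  show ?thesis
    unfolding output_controllable_def set_controllable_def P0 Pd ball_simps bex_simps
    using reach by simp
qed

end
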